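(* Let $H$ be an $r$-uniform hypergraph with $r \geq 3$, and let $H_{p,q}$ be any $(p,q)$-extension of $H$ (as defined in the context). Then $\chi(H_{p,q}) = \chi(H)$.
   Context: A hypergraph $H$ consists of a finite vertex set $V(H)$ and a family $E(H)$ of subsets of $V(H)$ (edges); it is $r$-uniform if every edge has exactly $r$ vertices. A classical colouring of an $r$-uniform hypergraph is an assignment of colours to vertices such that no edge is monochromatic; the chromatic number $\chi(H)$ is the minimum number of colours in such a colouring. $(p,q)$-extension: Let $H$ be $r$-uniform, $r\ge 3$, and let $E^*=\{v_1,\dots,v_r\}$ be an edge of $H$. Let $W=\{w_1,\dots,w_p\}$ ($p\ge 1$) and $U=\{u_1,\dots,u_q\}$ ($q \ge 0$) be sets of new vertices, pairwise disjoint from each other and from $V(H)$. Let $T$ be a non-empty subset of $\{1,2,\dots,\min\{p,\lfloor (r-1)/2\rfloor\}\}$. If $q\ge 1$, let $P$ be a non-empty subset of $\{1,\dots,\min\{p,r-2\}\}$ and $Q$ a non-empty subset of $\{1,\dots,\min\{q,r-2\}\}$ such that there exist $x\in P$, $y\in Q$ with $x+y\le r-1$. The $(p,q)$-extension $H_{p,q}$ has vertex set $V(H)\cup W\cup U$ and edge set consisting of all edges of $H$ together with: (Type 1) every $r$-set $K\subseteq E^*\cup W$ with $|K\cap W|\in T$; (Type 2, only when $q\ge 1$) every $r$-set $K\subseteq E^*\cup W\cup U$ with $|K\cap W|\in P$, $|K\cap U|\in Q$ and $|K\cap W|+|K\cap U|\le r-1$ (so the remaining $r-|K\cap W|-|K\cap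 U|$ vertices of $K$ lie in $E^*$). When $q=0$ there are no Type 2 edges. *)

theory Defs
  imports Main
begin

record 'a hypergraph =
  verts :: "'a set"
  edges :: "'a set set"

definition hypergraph :: "'a hypergraph \<Rightarrow> bool" where
  "hypergraph H \<longleftrightarrow> finite (verts H) \<and> (\<forall>e\<in>edges H. e \<subseteq> verts H)"

definition uniform_hypergraph :: "nat \<Rightarrow> 'a hypergraph \<Rightarrow> bool" where
  "uniform_hypergraph r H \<longleftrightarrow> hypergraph H \<and> (\<forall>e\<in>edges H. card e = r)"

definition monochromatic :: "('a \<Rightarrow> 'c) \<Rightarrow> 'a set \<Rightarrow> bool" where
  "monochromatic c e \<longleftrightarrow> (\<exists>a. \<forall>v\<in>e. c v = a)"

definition proper_colouring :: "'a hypergraph \<Rightarrow> ('a \<Rightarrow> 'c) \<Rightarrow> bool" where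
  "proper_colouring H c \<longleftrightarrow> (\<forall>e\<in>edges H. \<not> monochromatic c e)"

text \<open>The vertex set is finite, so the natural numbers provide enough colours.\<close>

definition chromatic_number :: "'a hypergraph \<Rightarrow> nat" where
  "chromatic_number H =
     (LEAST k. \<exists>c :: 'a \<Rightarrow> nat. proper_colouring H c \<and> card (c ` verts H) = k)"

definition type1_edges :: "nat \<Rightarrow> 'a set \<Rightarrow> 'a set \<Rightarrow> nat set \<Rightarrow> 'a set set" where
  "type1_edges r Es W T = {K. K \<subseteq> Es \<union> W \<and> card K = r \<and> card (K \<inter> W) \<in> T}"

definition type2_edges ::
  "nat \<Rightarrow> 'a set \<Rightarrow> 'a set \<Rightarrow> 'a set \<Rightarrow> nat set \<Rightarrow> nat set \<Rightarrow> 'a set set" where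
  "type2_edges r Es W U P Q =
     {K. K \<subseteq> Es \<union> W \<union> U \<and> card K = r \<and> card (K \<inter> W) \<in> P \<and> card (K \<inter> U) \<in> Q \<and>
         card (K \<inter> W) + card (K \<inter> U) \<le> r - 1}"

text \<open>\<open>pq_extension r p q H H'\<close>: the hypergraph \<open>H'\<close> is a \<open>(p,q)\<close>-extension of the
  \<open>r\<close>-uniform hypergraph \<open>H\<close>, for some choice of the edge \<open>Es\<close> (the distinguished edge
  \<open>E\<^sup>*\<close>), of the new vertices \<open>W\<close>, \<open>U\<close>, and of the index sets \<open>T\<close>, \<open>P\<close>, \<open>Q\<close>. For \<open>q = 0\<close>
  the sets \<open>P\<close> and \<open>Q\<close> are unconstrained and unused.\<close>

definition pq_extension ::
  "nat \<Rightarrow> nat \<Rightarrow> nat \<Rightarrow> 'a hypergraph \<Rightarrow> 'a hypergraph \<Rightarrow> bool" where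
  "pq_extension r p q H H' \<longleftrightarrow>
     (\<exists>Es W U T P Q.
        Es \<in> edges H \<and>
        finite W \<and> card W = p \<and> p \<ge> 1 \<and> finite U \<and> card U = q \<and>
        W \<inter> U = {} \<and> W \<inter> verts H = {} \<and> U \<inter> verts H = {} \<and>
        T \<noteq> {} \<and> T \<subseteq> {1..min p ((r - 1) div 2)} \<and>
        (q \<ge> 1 \<longrightarrow>
           P \<noteq> {} \<and> P \<subseteq> {1..min p (r - 2)} \<and>
           Q \<noteq> {} \<and> Q \<subseteq> {1..min q (r - 2)} \<and>
           (\<exists>x\<in>P. \<exists>y\<in>Q. x + y \<le> r - 1)) \<and>
        H' = \<lparr>verts = verts H \<union> W \<union> U,
              edges = edges H \<union> type1_edges r Es W T \<union>
                      (if q \<ge> 1 then type2_edges r Es W U P Q else {})\<rparr>)"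

end

theory Submission
  imports Defs
begin

text \<open>
  A proper colouring of \<open>H\<close> uses at least two colours on \<open>E\<^sup>*\<close>, so some colour \<open>a\<close> occurs on at
  most \<open>r/2\<close> of its vertices, and another colour \<open>b \<noteq> a\<close> occurs too. Colour \<open>W\<close> with \<open>a\<close> and \<open>U\<close>
  with \<open>b\<close>. A Type 1 edge meets \<open>W\<close> and has more than \<open>r/2\<close> vertices in \<open>E\<^sup>*\<close>, hence one not
  coloured \<open>a\<close>; a Type 2 edge meets both \<open>W\<close> and \<open>U\<close>. No new colour is needed.
\<close>

text \<open>Lets the two chromatic numbers be compared by transforming colourings in both
  directions, with no separate proof that a proper colouring exists.\<close>

lemma Least_eq_if_mutually_bounded:
  fixes P Q :: "nat \<Rightarrow> bool"
  assumes PQ: "\<And>k. P k \<Longrightarrow> \<exists>j\<le>k. Q j" and QP: "\<And>k. Q k \<Longrightarrow> \<exists>j\<le>k. P j"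
  shows "(LEAST k. P k) = (LEAST k. Q k)"
proof (cases "\<exists>k. P k")
  case True
  then have P: "P (LEAST k. P k)"
    by (rule LeastI_ex)
  then have "\<exists>k. Q k"
    using PQ by blast
  then have Q: "Q (LEAST k. Q k)"
    by (rule LeastI_ex)
  obtain i j where ij: "Q i" "i \<le> (LEAST k. P k)" "P j" "j \<le> (LEAST k. Q k)"
    using PQ [OF P] QP [OF Q] by blast
  show ?thesis
    using ij Least_le [of Q i] Least_le [of P j] by linarith
next
  case False
  \<comment> \<open>Both predicates are now false everywhere, so the two \<open>LEAST\<close> terms
    agree whatever their unspecified value is.\<close>
  then have "P = Q"
    using QP by blast
  then show ?thesis by simp
qed

text \<open>Two different colours that occur on \<open>e\<close> have disjoint classes inside
  \<open>e\<close>, so the smaller class fills at most half of it; its colour serves as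
  \<open>a\<close>, the other as \<open>b\<close>.\<close>

lemma obtain_minority_colour:
  assumes "finite e" "e \<noteq> {}" "\<not> monochromatic c e"
  obtains a b where "a \<in> c ` e" "b \<in> c ` e" "a \<noteq> b" "2 * card {v \<in> e. c v = a} \<le> card e"
proof -
  obtain v w where vw: "v \<in> e" "w \<in> e" "c v \<noteq> c w"
    using assms(2,3) unfolding monochromatic_def by blast
  have "card {x \<in> e. c x = c v} + card {x \<in> e. c x = c w}
      = card ({x \<in> e. c x = c v} \<union> {x \<in> e. c x = c w})"
    using assms(1) vw(3) by (intro card_Un_disjoint [symmetric]) auto
  also have "\<dots> \<le> card e"
    using assms(1) by (intro card_mono) auto
  finally have "2 * card {x \<in> e. c x = c v} \<le> card e \<or> 2 * card {x \<in> e. c x = c w} \<le> card e"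
    by linarith
  then show thesis
    using that [of "c v" "c w"] that [of "c w" "c v"] vw by auto
qed

lemma type1_edge_not_monochromatic:
  assumes e: "finite e" "2 * card {v \<in> e. c v = a} \<le> r" and W: "\<And>w. w \<in> W \<Longrightarrow> c w = a"
    and T: "T \<subseteq> {1..(r - 1) div 2}" and K: "K \<in> type1_edges r e W T"
  shows "\<not> monochromatic c K"
proof
  assume mono: "monochromatic c K"
  have K: "K \<subseteq> e \<union> W" "card K = r" "card (K \<inter> W) \<ge> 1" "card (K \<inter> W) \<le> (r - 1) div 2"
    using K T by (auto simp: type1_edges_def)
  then have "K \<inter> W \<noteq> {}"
    by auto
  \<comment> \<open>A vertex of \<open>K\<close> in \<open>W\<close> already has colour
    \<open>a\<close>, so no other common colour is possible.\<close>
  then have "\<forall>v\<in>K. c v = a"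
    using mono W unfolding monochromatic_def by (metis IntE ex_in_conv)
  then have "K \<subseteq> {v \<in> e. c v = a} \<union> (K \<inter> W)"
    using K(1) by auto
  \<comment> \<open>An infinite set has \<open>card\<close> 0, against the lower bound 1.\<close>
  moreover have "finite (K \<inter> W)"
    using K(3) by (metis card.infinite not_one_le_zero)
  ultimately have "card K \<le> card ({v \<in> e. c v = a} \<union> (K \<inter> W))"
    using e(1) by (intro card_mono) auto
  also have "\<dots> \<le> card {v \<in> e. c v = a} + card (K \<inter> W)"
    by (rule card_Un_le)
  \<comment> \<open>Doubling gives \<open>2 * r \<le> r + (r - 1)\<close>; the \<open>r - 1\<close>
    in the bound on \<open>T\<close> makes this strict even when \<open>a\<close> fills exactly half
    of \<open>e\<close>.\<close>
  finally show False
    using K(2-4) e(2) by linarith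
qed

lemma type2_edge_not_monochromatic:
  assumes W: "\<And>w. w \<in> W \<Longrightarrow> c w = a" and U: "\<And>u. u \<in> U \<Longrightarrow> c u = b" and "a \<noteq> b"
    and "0 \<notin> P" "0 \<notin> Q" and K: "K \<in> type2_edges r e W U P Q"
  shows "\<not> monochromatic c K"
proof -
  \<comment> \<open>An empty intersection would put its \<open>card\<close>, 0, into
    \<open>P\<close> or \<open>Q\<close>.\<close>
  have "K \<inter> W \<noteq> {}" "K \<inter> U \<noteq> {}"
    using K assms(4,5) by (auto simp: type2_edges_def)
  then show ?thesis
    using W U \<open>a \<noteq> b\<close> unfolding monochromatic_def by (metis IntE ex_in_conv)
qed

text \<open>Equality of the images, not just of their sizes, records that the new vertices reuse
  colours of \<open>H\<close>.\<close>

lemma pq_extension_colouring_extends: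
  fixes c :: "'a \<Rightarrow> 'c"
  assumes r: "r \<ge> 1" and unif: "uniform_hypergraph r H" and ext: "pq_extension r p q H H'"
    and c: "proper_colouring H c"
  obtains c' :: "'a \<Rightarrow> 'c" where "proper_colouring H' c'" "c' ` verts H' = c ` verts H"
proof -
  obtain Es W U T P Q where Es: "Es \<in> edges H"
    and disj: "W \<inter> U = {}" "W \<inter> verts H = {}" "U \<inter> verts H = {}"
    and T: "T \<subseteq> {1..min p ((r - 1) div 2)}"
    and PQ: "q \<ge> 1 \<Longrightarrow> P \<subseteq> {1..min p (r - 2)} \<and> Q \<subseteq> {1..min q (r - 2)}"
    and H': "H' = \<lparr>verts = verts H \<union> W \<union> U,
              edges = edges H \<union> type1_edges r Es W T \<union>
                      (if q \<ge> 1 then type2_edges r Es W U P Q else {})\<rparr>"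
    using ext unfolding pq_extension_def by blast
  have edge_sub: "\<And>e. e \<in> edges H \<Longrightarrow> e \<subseteq> verts H" and "card Es = r" "finite Es"
    using unif Es r unfolding uniform_hypergraph_def hypergraph_def
    by (auto intro: finite_subset)
  have "Es \<noteq> {}"
    using \<open>card Es = r\<close> r by auto
  moreover have "\<not> monochromatic c Es"
    using c Es unfolding proper_colouring_def by blast
  ultimately obtain a b where ab: "a \<in> c ` Es" "b \<in> c ` Es" "a \<noteq> b"
    and minority: "2 * card {v \<in> Es. c v = a} \<le> r"
    using obtain_minority_colour [OF \<open>finite Es\<close>] \<open>card Es = r\<close> by blast
  define c' where "c' = (\<lambda>v. if v \<in> W then a else if v \<in> U then b else c v)"
  have W: "c' w = a" if "w \<in> W" for w
    using that by (simp add: c'_def)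
  have U: "c' u = b" if "u \<in> U" for u
    using that disj by (auto simp: c'_def)
  have old: "c' v = c v" if "v \<in> verts H" for v
    using that disj by (auto simp: c'_def)
  have "\<not> monochromatic c' K" if K: "K \<in> edges H'" for K
  proof -
    consider "K \<in> edges H" | "K \<in> type1_edges r Es W T"
      | "q \<ge> 1" "K \<in> type2_edges r Es W U P Q"
      using K unfolding H' by (auto split: if_splits)
    then show ?thesis
    proof cases
      case 1
      then have "\<forall>v\<in>K. c' v = c v"
        using edge_sub old by blast
      then show ?thesis
        using c 1 unfolding proper_colouring_def monochromatic_def by auto
    next
      case 2
      \<comment> \<open>Recolouring touches only vertices outside \<open>H\<close>, so the half
        bound carries over to \<open>c'\<close>.\<close>
      have "{v \<in> Es. c' v = a} = {v \<in> Es. c v = a}"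
        using edge_sub [OF Es] old by auto
      then have "2 * card {v \<in> Es. c' v = a} \<le> r"
        using minority by simp
      moreover have "T \<subseteq> {1..(r - 1) div 2}"
        using T by auto
      ultimately show ?thesis
        using \<open>finite Es\<close> W 2 by (intro type1_edge_not_monochromatic)
    next
      case 3
      have "0 \<notin> P" "0 \<notin> Q"
        using PQ [OF 3(1)] by auto
      then show ?thesis
        using W U \<open>a \<noteq> b\<close> 3(2) by (intro type2_edge_not_monochromatic)
    qed
  qed
  then have "proper_colouring H' c'"
    unfolding proper_colouring_def by blast
  moreover have "c' ` verts H' = c ` verts H"
  proof
    show "c' ` verts H' \<subseteq> c ` verts H"
      \<comment> \<open>Both \<open>a\<close> and \<open>b\<close> occur on \<open>Es\<close>, hence
        on \<open>verts H\<close>.\<close>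
      using W U old ab edge_sub [OF Es] unfolding H' by auto
    show "c ` verts H \<subseteq> c' ` verts H'"
      using old unfolding H' by force
  qed
  ultimately show thesis
    using that by blast
qed

theorem theorem2p1:
  fixes H Hpq :: "'a hypergraph" and r p q :: nat
  assumes "r \<ge> 3"
    and "uniform_hypergraph r H"
    and "pq_extension r p q H Hpq"
  shows "chromatic_number Hpq = chromatic_number H"
  unfolding chromatic_number_def
proof (rule Least_eq_if_mutually_bounded)
  fix k
  assume "\<exists>c :: 'a \<Rightarrow> nat. proper_colouring Hpq c \<and> card (c ` verts Hpq) = k"
  then obtain c :: "'a \<Rightarrow> nat" where c: "proper_colouring Hpq c" "card (c ` verts Hpq) = k"
    by blast
  \<comment> \<open>A colouring of the extension restricts to \<open>H\<close>; finiteness makes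
    \<open>card\<close> monotone on the colour sets.\<close>
  have "edges H \<subseteq> edges Hpq" "verts H \<subseteq> verts Hpq" "finite (verts Hpq)"
    using assms(2,3) unfolding pq_extension_def uniform_hypergraph_def hypergraph_def by auto
  then have "proper_colouring H c" "card (c ` verts H) \<le> k"
    using c card_mono [of "c ` verts Hpq" "c ` verts H"]
    unfolding proper_colouring_def by (auto simp: image_mono)
  then show "\<exists>j\<le>k. \<exists>c :: 'a \<Rightarrow> nat. proper_colouring H c \<and> card (c ` verts H) = j"
    by blast
next
  fix k
  assume "\<exists>c :: 'a \<Rightarrow> nat. proper_colouring H c \<and> card (c ` verts H) = k"
  then obtain c :: "'a \<Rightarrow> nat" where c: "proper_colouring H c" "card (c ` verts H) = k"
    by blast
  have "r \<ge> 1"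
    using assms(1) by simp
  then obtain c' :: "'a \<Rightarrow> nat" where "proper_colouring Hpq c'" "c' ` verts Hpq = c ` verts H"
    using pq_extension_colouring_extends [OF _ assms(2,3) c(1)] by blast
  then show "\<exists>j\<le>k. \<exists>c :: 'a \<Rightarrow> nat. proper_colouring Hpq c \<and> card (c ` verts Hpq) = j"
    using c(2) by (metis order_refl)
qed

end
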